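(* Let $\lambda,c>0$ and $p=p(n)=1-\lambda n^{-c}$ (for $n$ large enough that $p\in(0,1)$). Let $X_n$ be the number of correct guesses in the card guessing game with complete feedback on a deck of $n$ cards shuffled once by the asymmetric riffle shuffle with parameter $p(n)$, under the optimal strategy. Then, as $n\to\infty$: for $c>1$, $n-X_n\xrightarrow{d}0$; for $c=1$, $n-X_n\xrightarrow{d}\mathrm{Po}(\lambda)$ (Poisson with mean $\lambda$); for $0<c<1$, $\dfrac{n-X_n-\lambda n^{1-c}}{\sqrt{\lambda n^{1-c}}}\xrightarrow{d}\mathcal N(0,1)$.
   Context: Asymmetric riffle shuffle with parameter $p\in(0,1)$ of the ordered deck $1,\dots,n$: take a random word $W_1\cdots W_n$ over $\{a,b\}$ with i.i.d. letters, $\mathbb{P}\{W_i=a\}=p$; if it has $k$ letters $a$, replace the $a$'s from left to right by $1,\dots,k$ and the $b$'s from left to right by $k+1,\dots,n$; the result is the deck from top to bottom. Guessing game with complete feedback: cards are revealed one at a time from the top; before each reveal the guesser names a label, and afterwards the card is shown. The optimal strategy guesses at each step a label of maximal conditional probability of being the next card given the cards revealed so far (ties broken arbitrarily); $X_n$ counts the correct guesses. *)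

theory Defs
  imports "HOL-Probability.Probability"
begin

(* A word over {a, b} is a boolean list in which True stands for the letter a. With 0-based
   positions, the letter a at position i is its (number of a's in w_0 ... w_i)-th occurrence. *)
definition riffle :: "bool list \<Rightarrow> nat list" where
  "riffle w = map (\<lambda>i. if w ! i then count_list (take (Suc i) w) True
                       else count_list w True + count_list (take (Suc i) w) False) [0..<length w]"

definition deck_pmf :: "nat \<Rightarrow> real \<Rightarrow> nat list pmf" where
  "deck_pmf n p = map_pmf riffle (replicate_pmf n (bernoulli_pmf p))"

(* A strategy maps the list of cards revealed so far (first revealed card first) to a guess.
   Optimality only constrains histories that occur with positive probability, and allows any
   label attaining the maximal conditional probability. *)
definition optimal_strategy :: "nat \<Rightarrow> real \<Rightarrow> (nat list \<Rightarrow> nat) \<Rightarrow> bool" where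
  "optimal_strategy n p g \<longleftrightarrow>
     (\<forall>d \<in> set_pmf (deck_pmf n p). \<forall>i < n.
        is_arg_max (\<lambda>x. \<P>(e in deck_pmf n p. e ! i = x \<bar> take i e = take i d))
                   (\<lambda>x. x \<in> {1..n}) (g (take i d)))"

definition correct_guesses :: "(nat list \<Rightarrow> nat) \<Rightarrow> nat list \<Rightarrow> nat" where
  "correct_guesses g d = card {i. i < length d \<and> g (take i d) = d ! i}"

end

theory Submission
  imports Defs "HOL-Real_Asymp.Real_Asymp"
begin

text \<open>
  Call a word \<open>a\<close>-dominant if each of its nonempty suffixes contains more letters \<open>a\<close> than
  letters \<open>b\<close>. On an \<open>a\<close>-dominant word, for \<open>p > 1/2\<close>, the next \<open>a\<close>-card is at every step the
  unique optimal guess: as long as the deck looks like the identity because \<open>p > 1 - p\<close>, and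
  afterwards because the history reveals the number of letters \<open>a\<close>, so that the remaining letters
  are a uniformly random arrangement with a majority of \<open>a\<close>'s. Hence the wrong guesses are exactly
  the letters \<open>b\<close>. A union bound over suffixes shows that a word fails to be \<open>a\<close>-dominant with
  probability at most \<open>4 sqrt (1 - p)\<close>, which vanishes for every \<open>c > 0\<close>. The number of wrong
  guesses therefore has the same limits as a binomial variable with parameters \<open>n\<close> and \<open>1 - p\<close>,
  whose characteristic function is compared with that of a Poisson variable.
\<close>

section \<open>Histories of a riffled deck\<close>

lemma count_list_True_plus_False: "count_list w True + count_list w False = length w"
  by (induction w) auto

lemma count_list_take_mono:
  assumes "i \<le> j"
  shows "count_list (take i w) x \<le> count_list (take j w) x"
proof -
  have "take j w = take i w @ take (j - i) (drop i w)"
    using assms by (metis le_add_diff_inverse take_add)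
  then show ?thesis by simp
qed

lemma count_list_take_le: "count_list (take i w) x \<le> count_list w x"
  by (metis append_take_drop_id count_list_append le_add1)

lemma length_riffle [simp]: "length (riffle w) = length w"
  by (simp add: riffle_def)

lemma riffle_nth:
  "i < length w \<Longrightarrow> riffle w ! i =
     (if w ! i then Suc (count_list (take i w) True)
      else Suc (count_list w True + count_list (take i w) False))"
  by (simp add: riffle_def take_Suc_conv_app_nth)

text \<open>Labels up to the number of \<open>a\<close>'s go to \<open>a\<close>-cards, so a card
  reveals its letter once that number is known.\<close>

lemma riffle_nth_le_iff:
  assumes "i < length w"
  shows "riffle w ! i \<le> count_list w True \<longleftrightarrow> w ! i"
proof -
  have "w ! i \<Longrightarrow> Suc (count_list (take i w) True) \<le> count_list w True"
    using count_list_take_le[of "Suc i" w True] assms by (simp add: take_Suc_conv_app_nth)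
  then show ?thesis
    using assms by (auto simp: riffle_nth)
qed

lemma riffle_nth_all_True:
  assumes "i < length w" "False \<notin> set (take (Suc i) w)"
  shows "riffle w ! i = Suc i"
proof -
  have "w ! i"
    using assms by (metis (full_types) UnI2 list.set_intros(1) set_append take_Suc_conv_app_nth)
  moreover have "count_list (take i w) False = 0"
    using assms by (auto simp: count_list_0_iff take_Suc_conv_app_nth)
  then have "count_list (take i w) True = i"
    using count_list_True_plus_False[of "take i w"] assms by simp
  ultimately show ?thesis
    using assms by (simp add: riffle_nth)
qed

text \<open>An \<open>a\<close> at position \<open>j\<close> has a label at most
  \<open>j + 1\<close>. A \<open>b\<close> exceeds \<open>j + 1\<close> only if some
  \<open>a\<close> is still to come, since its label counts all \<open>a\<close>'s but only the
  earlier \<open>b\<close>'s.\<close>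

lemma visible_b_imp:
  assumes "j < length v" "Suc j < riffle v ! j"
  shows "\<not> v ! j" and "count_list (take (Suc j) v) True < count_list v True"
proof -
  have *: "count_list (take j v) True + count_list (take j v) False = j"
    using assms count_list_True_plus_False[of "take j v"] by simp
  show "\<not> v ! j"
    using assms * by (auto simp: riffle_nth split: if_splits)
  then show "count_list (take (Suc j) v) True < count_list v True"
    using assms * by (auto simp: riffle_nth take_Suc_conv_app_nth)
qed

text \<open>A \<open>b\<close> at \<open>l\<close> showing \<open>l + 1\<close> would mean that
  every \<open>a\<close> precedes \<open>l\<close>, whereas the out-of-order card at
  \<open>j\<close> requires an \<open>a\<close> after \<open>j\<close>.\<close>

lemma visible_b_prefix_True:
  assumes "j < length v" "Suc j < riffle v ! j" "\<And>l. l < j \<Longrightarrow> riffle v ! l = Suc l" "l < j"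
  shows "v ! l"
proof (rule ccontr)
  assume "\<not> v ! l"
  moreover have "count_list (take l v) True < count_list v True"
    using visible_b_imp(2)[OF assms(1,2)] count_list_take_mono[of l "Suc j" v True] assms(4)
    by linarith
  moreover have "count_list (take l v) True + count_list (take l v) False = l"
    using assms count_list_True_plus_False[of "take l v"] by simp
  ultimately show False
    using assms(3)[OF assms(4)] assms(1,4) by (simp add: riffle_nth)
qed

lemma riffle_first_visible_b:
  assumes "j < length v" "Suc j < riffle v ! j" "\<And>l. l < j \<Longrightarrow> riffle v ! l = Suc l"
  shows "riffle v ! j = Suc (count_list v True)"
proof -
  have "False \<notin> set (take j v)"
    using visible_b_prefix_True[OF assms] assms(1) by (auto simp: in_set_conv_nth)
  then show ?thesis
    using visible_b_imp(1)[OF assms(1,2)] assms(1) by (simp add: riffle_nth)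
qed

text \<open>
  Once a visible out-of-order card has been shown, it names the number of letters \<open>a\<close>, and
  every earlier letter can be read off by comparing its card with that number.
\<close>
lemma riffle_history_determines_word:
  assumes len: "length v = length w" and hist: "take i (riffle v) = take i (riffle w)"
    and b: "False \<in> set (take i w)" and a: "True \<in> set (drop i w)"
  shows "count_list v True = count_list w True" and "take i v = take i w"
proof -
  have eq: "riffle v ! l = riffle w ! l" if "l < i" for l
    using hist that by (metis nth_take)
  define j where "j = (LEAST j. j < length w \<and> \<not> w ! j)"
  obtain j0 where j0: "j0 < i" "j0 < length w" "\<not> w ! j0"
    using b by (auto simp: in_set_conv_nth)
  have j: "j < length w" "\<not> w ! j" "j < i"
    using LeastI[of "\<lambda>j. j < length w \<and> \<not> w ! j" j0] Least_le[of "\<lambda>j. j < length w \<and> \<not> w ! j" j0] j0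
    unfolding j_def by auto
  have pre: "w ! l" if "l < j" for l
    using not_less_Least[of l "\<lambda>j. j < length w \<and> \<not> w ! j"] that j(1) unfolding j_def by auto
  have noF: "False \<notin> set (take j w)"
    using pre j(1) by (auto simp: in_set_conv_nth)
  have w_pre: "riffle w ! l = Suc l" if "l < j" for l
  proof (rule riffle_nth_all_True)
    show "False \<notin> set (take (Suc l) w)"
      using noF set_take_subset_set_take[of "Suc l" j w] that by auto
  qed (use that j in auto)
  have "count_list (take i w) True + count_list (drop i w) True = count_list w True"
    by (metis append_take_drop_id count_list_append)
  moreover have "count_list (drop i w) True \<noteq> 0"
    using a by (simp add: count_list_0_iff)
  moreover have "count_list (take j w) True = j"
    using count_list_True_plus_False[of "take j w"] noF j by simp
  \<comment> \<open>The \<open>j\<close> letters before the first \<open>b\<close> are all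
    \<open>a\<close>, and \<open>drop i w\<close> holds another \<open>a\<close>; hence the label of
    that \<open>b\<close> exceeds \<open>j + 1\<close> and breaks the identity order.\<close>
  ultimately have "j < count_list w True"
    using count_list_take_mono[of j i w True] j by linarith
  moreover have w_j: "riffle w ! j = Suc (count_list w True)"
    using j noF by (simp add: riffle_nth)
  ultimately have vis: "Suc j < riffle v ! j"
    using eq j by simp
  have "riffle v ! j = Suc (count_list v True)"
    by (rule riffle_first_visible_b) (use vis w_pre j len eq in auto)
  then show count: "count_list v True = count_list w True"
    using w_j eq j by simp
  show "take i v = take i w"
  proof (rule nth_equalityI)
    fix l assume "l < length (take i v)"
    then show "take i v ! l = take i w ! l"
      using riffle_nth_le_iff[of l v] riffle_nth_le_iff[of l w] eq[of l] count len by simp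
  qed (use len in simp)
qed

text \<open>A \<open>b\<close> among the first \<open>i\<close> letters showing its identity value
  would mean that no \<open>a\<close> is left, so the card at \<open>i\<close> would be in identity
  order too. Hence these letters are all \<open>a\<close>, and a further \<open>a\<close> would show
  \<open>i + 1\<close>.\<close>

lemma riffle_break_after_identity:
  assumes "i < length v" "\<And>l. l < i \<Longrightarrow> riffle v ! l = Suc l" "riffle v ! i \<noteq> Suc i"
  shows "take (Suc i) v = replicate i True @ [False]"
proof -
  have sum: "count_list (take l v) True + count_list (take l v) False = l" if "l \<le> length v" for l
    using that count_list_True_plus_False[of "take l v"] by simp
  have pre: "v ! l" if "l < i" for l
  proof (rule ccontr)
    assume nv: "\<not> v ! l"
    then have "count_list v True = count_list (take (Suc l) v) True"
      using assms(1) assms(2)[OF that] sum[of l] that by (simp add: riffle_nth take_Suc_conv_app_nth)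
    moreover have "count_list (take (Suc l) v) True \<le> count_list (take i v) True"
      using that by (intro count_list_take_mono) simp
    moreover have "count_list (take i v) True \<le> count_list (take (Suc i) v) True"
      by (intro count_list_take_mono) simp
    moreover have "count_list (take (Suc i) v) True \<le> count_list v True"
      by (rule count_list_take_le)
    ultimately have eq: "count_list (take i v) True = count_list v True"
      "count_list (take (Suc i) v) True = count_list v True" by linarith+
    then have "\<not> v ! i"
      using assms(1) by (auto simp: take_Suc_conv_app_nth)
    then show False
      using assms(1,3) sum[of i] eq by (simp add: riffle_nth)
  qed
  have "take i v = replicate i True"
    using pre assms(1) by (intro nth_equalityI) auto
  moreover from this have "\<not> v ! i"
    using assms(1,3) sum[of i] by (auto simp: riffle_nth)
  ultimately show ?thesis
    using assms(1) by (simp add: take_Suc_conv_app_nth)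
qed

text \<open>The suffix from \<open>i\<close> consists of the letters not yet revealed at step
  \<open>i\<close>, so the \<open>a\<close>'s keep a strict majority among the remaining cards.
  Recursion on the tail fits the induction in the union bound.\<close>

fun a_dominant :: "bool list \<Rightarrow> bool" where
  "a_dominant [] \<longleftrightarrow> True"
| "a_dominant (x # w) \<longleftrightarrow> count_list (x # w) False < count_list (x # w) True \<and> a_dominant w"

lemma a_dominant_drop: "a_dominant w \<Longrightarrow> a_dominant (drop i w)"
proof (induction w arbitrary: i)
  case (Cons x w)
  then show ?case by (cases i) auto
qed simp

lemma a_dominant_count:
  assumes "a_dominant w" "i < length w"
  shows "count_list (drop i w) False < count_list (drop i w) True"
proof -
  have "drop i w \<noteq> []" using assms(2) by simp
  then obtain x u where "drop i w = x # u" by (cases "drop i w") auto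
  then show ?thesis using a_dominant_drop[OF assms(1), of i] by simp
qed

section \<open>Optimal guesses\<close>

lemma replicate_pmf_Suc_map:
  "replicate_pmf (Suc n) P = P \<bind> (\<lambda>x. map_pmf ((#) x) (replicate_pmf n P))"
  by (simp add: map_pmf_def)

text \<open>By independence, conditioning on the first letter peels off one factor at a time. The
  event \<open>U\<close> will fix the number of \<open>a\<close>'s after the prefix.\<close>

lemma prob_replicate_pmf_prefix:
  "measure_pmf.prob (replicate_pmf (length pre + m) P) {v. take (length pre) v = pre \<and> drop (length pre) v \<in> U} =
     (\<Prod>x\<leftarrow>pre. pmf P x) * measure_pmf.prob (replicate_pmf m P) U"
proof (induction pre)
  case (Cons a pre)
  let ?A = "\<lambda>pre. {v. take (length pre) v = pre \<and> drop (length pre) v \<in> U}"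
  let ?R = "replicate_pmf (length pre + m) P"
  have "emeasure (replicate_pmf (length (a # pre) + m) P) (?A (a # pre)) =
      (\<integral>\<^sup>+ x. emeasure ?R (?A pre) * indicator {a} x \<partial>measure_pmf P)"
    unfolding length_Cons add_Suc replicate_pmf_Suc_map emeasure_bind_pmf
    by (intro nn_integral_cong) (auto simp: indicator_def vimage_def)
  also have "\<dots> = emeasure ?R (?A pre) * pmf P a"
    by (simp add: nn_integral_cmult_indicator emeasure_pmf_single)
  finally have "measure_pmf.prob (replicate_pmf (length (a # pre) + m) P) (?A (a # pre)) =
      measure_pmf.prob ?R (?A pre) * pmf P a"
    by (simp add: measure_def enn2real_mult)
  then show ?case
    using Cons.IH by simp
qed simp

lemma length_replicate_pmf: "v \<in> set_pmf (replicate_pmf n P) \<Longrightarrow> length v = n"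
  by (simp add: set_replicate_pmf)

lemma prob_replicate_pmf_prefix':
  assumes "length pre \<le> n"
  shows "measure_pmf.prob (replicate_pmf n P) {v. take (length pre) v = pre} = (\<Prod>x\<leftarrow>pre. pmf P x)"
  using prob_replicate_pmf_prefix[of pre "n - length pre" P UNIV] assms by simp

lemma prob_count_list_True:
  fixes p :: real
  assumes "p \<in> {0..1}"
  shows "measure_pmf.prob (replicate_pmf m (bernoulli_pmf p)) {u. count_list u True = a} =
           (m choose a) * p ^ a * (1 - p) ^ (m - a)"
proof -
  have "count_list u True = length (filter id u)" for u
    by (induction u) auto
  then have "measure_pmf.prob (replicate_pmf m (bernoulli_pmf p)) {u. count_list u True = a} =
      pmf (binomial_pmf m p) a"
    unfolding binomial_pmf_altdef[OF assms] measure_pmf_single[symmetric] by (simp add: vimage_def)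
  then show ?thesis
    using assms by simp
qed

text \<open>All conditional probabilities given the history share one positive denominator, so joint
  probabilities can be compared. Strictness against every other label rules out ties.\<close>

lemma optimal_guess_unique:
  assumes opt: "optimal_strategy n p g" and p: "0 < p" "p < 1"
    and w: "length w = n" "i < n" and x0: "x0 \<in> {1..n}"
    and less: "\<And>x. x \<noteq> x0 \<Longrightarrow>
      measure_pmf.prob (replicate_pmf n (bernoulli_pmf p))
        {v. riffle v ! i = x \<and> take i (riffle v) = take i (riffle w)} <
      measure_pmf.prob (replicate_pmf n (bernoulli_pmf p))
        {v. riffle v ! i = x0 \<and> take i (riffle v) = take i (riffle w)}"
  shows "g (take i (riffle w)) = x0"
proof (rule ccontr)
  assume neq: "g (take i (riffle w)) \<noteq> x0"
  let ?D = "deck_pmf n p"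
  let ?x = "g (take i (riffle w))"
  have mem: "w \<in> set_pmf (replicate_pmf n (bernoulli_pmf p))"
    using p w by (simp add: set_replicate_pmf)
  then have "riffle w \<in> set_pmf ?D"
    by (simp add: deck_pmf_def)
  then have "\<not> \<P>(e in ?D. e ! i = ?x \<bar> take i e = take i (riffle w)) <
      \<P>(e in ?D. e ! i = x0 \<bar> take i e = take i (riffle w))"
    using opt w x0 unfolding optimal_strategy_def is_arg_max_def by blast
  moreover have "0 < measure_pmf.prob (replicate_pmf n (bernoulli_pmf p))
      {v. take i (riffle v) = take i (riffle w)}"
    using mem by (intro measure_pmf_posI) auto
  ultimately show False
    using less[OF neq] by (simp add: cond_prob_def deck_pmf_def vimage_def divide_strict_right_mono)
qed

text \<open>The history is the identity. Any next card other than \<open>i + 1\<close> forces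
  \<open>i\<close> letters \<open>a\<close> and then a \<open>b\<close>, of probability
  \<open>p ^ i * (1 - p)\<close>; starting with \<open>i + 1\<close> letters \<open>a\<close>
  already has the larger probability \<open>p ^ i * p\<close>.\<close>

lemma optimal_guess_before_visible_b:
  assumes opt: "optimal_strategy n p g" and p: "1 / 2 < p" "p < 1"
    and w: "length w = n" "i < n" and pre: "False \<notin> set (take i w)"
  shows "g (take i (riffle w)) = Suc i"
proof (rule optimal_guess_unique[OF opt _ p(2) w])
  fix x assume x: "x \<noteq> Suc i"
  let ?R = "replicate_pmf n (bernoulli_pmf p)"
  let ?S = "\<lambda>x. {v. riffle v ! i = x \<and> take i (riffle v) = take i (riffle w)}"
  have noF: "False \<notin> set (take l w)" if "l \<le> i" for l
    using pre set_take_subset_set_take[OF that, of w] by auto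
  have id: "riffle w ! l = Suc l" if "l < i" for l
    using that w noF[of "Suc l"] by (intro riffle_nth_all_True) auto
  have "measure_pmf.prob ?R (?S x) \<le>
      measure_pmf.prob ?R {v. take (length (replicate i True @ [False])) v = replicate i True @ [False]}"
  proof (rule measure_pmf.finite_measure_mono_AE)
    show "AE v in ?R. v \<in> ?S x \<longrightarrow>
        v \<in> {v. take (length (replicate i True @ [False])) v = replicate i True @ [False]}"
    proof (rule AE_pmfI, rule impI)
      fix v assume v: "v \<in> set_pmf ?R" "v \<in> ?S x"
      have "riffle v ! l = Suc l" if "l < i" for l
        using v id[OF that] that by (metis (mono_tags, lifting) mem_Collect_eq nth_take)
      then show "v \<in> {v. take (length (replicate i True @ [False])) v = replicate i True @ [False]}"
        using riffle_break_after_identity[of i v] v x w by (auto simp: length_replicate_pmf)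
    qed
  qed simp
  also have "\<dots> = p ^ i * (1 - p)"
    using w p by (subst prob_replicate_pmf_prefix') (auto simp: map_replicate_const prod_list_replicate)
  also have "\<dots> < p ^ i * p"
    using p by (intro mult_strict_left_mono) auto
  also have "\<dots> = measure_pmf.prob ?R
      {v. take (length (replicate (Suc i) True)) v = replicate (Suc i) True}"
    using w p by (subst prob_replicate_pmf_prefix') (auto simp: map_replicate_const prod_list_replicate)
  \<comment> \<open>Words with an earlier \<open>b\<close> hidden in an identity deck may also show
    \<open>i + 1\<close>; they only enlarge the right side.\<close>
  also have "\<dots> \<le> measure_pmf.prob ?R (?S (Suc i))"
  proof (rule measure_pmf.finite_measure_mono_AE)
    show "AE v in ?R. v \<in> {v. take (length (replicate (Suc i) True)) v = replicate (Suc i) True} \<longrightarrow>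
        v \<in> ?S (Suc i)"
    proof (rule AE_pmfI, rule impI)
      fix v assume v: "v \<in> set_pmf ?R"
        "v \<in> {v. take (length (replicate (Suc i) True)) v = replicate (Suc i) True}"
      have len: "length v = n"
        using v by (simp add: length_replicate_pmf)
      have noF_v: "False \<notin> set (take (Suc l) v)" if "l \<le> i" for l
      proof -
        have "set (take (Suc l) v) \<subseteq> set (take (Suc i) v)"
          using that by (intro set_take_subset_set_take) simp
        also have "take (Suc i) v = replicate (Suc i) True"
          using v by simp
        finally show ?thesis
          by (auto split: if_splits)
      qed
      have id_v: "riffle v ! l = Suc l" if "l \<le> i" for l
        using that len w noF_v by (intro riffle_nth_all_True) auto
      have "take i (riffle v) = take i (riffle w)"
        using id id_v w len by (intro nth_equalityI) auto
      then show "v \<in> ?S (Suc i)"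
        using id_v by simp
    qed
  qed simp
  finally show "measure_pmf.prob ?R (?S x) < measure_pmf.prob ?R (?S (Suc i))" .
qed (use p w in auto)

text \<open>The ratio of the coefficients is \<open>(m + 1 - a) / a\<close>, which is below 1. At
  \<open>a = m + 1\<close> they are 0 and 1.\<close>

lemma choose_less_choose_pred:
  assumes "Suc m < 2 * a" "a \<le> Suc m"
  shows "m choose a < m choose (a - 1)"
proof -
  obtain b where a: "a = Suc b" using assms by (cases a) auto
  show ?thesis
  proof (cases "b < m")
    case True
    then obtain d where m: "m = Suc (b + d)" using less_imp_Suc_add by blast
    have "Suc b * (m choose Suc b) = Suc d * (m choose b)"
      unfolding m by (rule Suc_times_binomial_add)
    also have "\<dots> < Suc b * (m choose b)"
      using assms unfolding a m by (intro mult_strict_right_mono) auto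
    finally show ?thesis
      unfolding a by (simp del: mult_Suc)
  next
    case False
    then show ?thesis using assms a by auto
  qed
qed

text \<open>The history fixes the first \<open>i\<close> letters and the number of
  \<open>a\<close>'s. All arrangements of the remaining \<open>A\<close> letters \<open>a\<close>
  and \<open>B\<close> letters \<open>b\<close> have equal weight; with
  \<open>m = A + B - 1\<close>, \<open>m choose (A - 1)\<close> of them begin with \<open>a\<close>
  and \<open>m choose A\<close> with \<open>b\<close>. The majority \<open>B < A\<close> makes the
  former larger.\<close>

lemma optimal_guess_after_visible_b:
  assumes opt: "optimal_strategy n p g" and p: "0 < p" "p < 1"
    and w: "length w = n" "i < n" and b: "False \<in> set (take i w)"
    and dom: "count_list (drop i w) False < count_list (drop i w) True"
  shows "g (take i (riffle w)) = Suc (count_list (take i w) True)"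
proof -
  let ?R = "replicate_pmf n (bernoulli_pmf p)"
  let ?S = "\<lambda>x. {v. riffle v ! i = x \<and> take i (riffle v) = take i (riffle w)}"
  let ?x0 = "Suc (count_list (take i w) True)"
  define k where "k = count_list w True"
  define A where "A = count_list (drop i w) True"
  define B where "B = count_list (drop i w) False"
  define m where "m = n - Suc i"
  have AB: "A + B = Suc m" "B < A"
    using dom count_list_True_plus_False[of "drop i w"] w by (auto simp: A_def B_def m_def)
  have k: "k = count_list (take i w) True + A"
    unfolding k_def A_def by (metis append_take_drop_id count_list_append)
  have a: "True \<in> set (drop i w)"
    using dom by (metis count_list_0_iff not_less_zero)
  \<comment> \<open>\<open>E x r\<close> prescribes the first \<open>i + 1\<close> letters, ending
    in \<open>x\<close>, and leaves \<open>r\<close> letters \<open>a\<close> for the other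
    \<open>m\<close> positions.\<close>
  define E where "E = (\<lambda>x r. {v. take (length (take i w @ [x])) v = take i w @ [x] \<and>
    drop (length (take i w @ [x])) v \<in> {u. count_list u True = r}})"
  define c where "c = (\<Prod>x\<leftarrow>take i w. pmf (bernoulli_pmf p) x)"
  have prob_E: "measure_pmf.prob ?R (E x r) =
      c * pmf (bernoulli_pmf p) x * ((m choose r) * p ^ r * (1 - p) ^ (m - r))" for x r
  proof -
    have n: "n = length (take i w @ [x]) + m"
      using w by (simp add: m_def)
    show ?thesis
      unfolding E_def
      by (subst n, subst prob_replicate_pmf_prefix, subst prob_count_list_True)
         (use p in \<open>auto simp: c_def\<close>)
  qed
  have c: "0 < c"
  proof -
    have "0 < (\<Prod>x\<leftarrow>u. pmf (bernoulli_pmf p) x)" for u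
    proof (induction u)
      case (Cons x u)
      then show ?case using p by (cases x) auto
    qed simp
    then show ?thesis by (simp add: c_def)
  qed
  have v_eq: "take i v = take i w" "count_list v True = k"
    if "length v = n" "take i (riffle v) = take i (riffle w)" for v
    using riffle_history_determines_word[OF _ that(2) b a] that(1) w by (auto simp: k_def)
  \<comment> \<open>Given the history, only a \<open>b\<close> can produce a card other than
    \<open>?x0\<close>, so one bound covers all competing labels.\<close>
  have S_sub: "AE v in ?R. v \<in> ?S x \<longrightarrow> v \<in> E False A" if "x \<noteq> ?x0" for x
  proof (rule AE_pmfI, rule impI)
    fix v assume v: "v \<in> set_pmf ?R" "v \<in> ?S x"
    have len: "length v = n"
      using v by (simp add: length_replicate_pmf)
    have pre: "take i v = take i w" "count_list v True = k"
      using v_eq[OF len] v by auto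
    have "\<not> v ! i"
      using v that pre len w by (auto simp: riffle_nth)
    then have "take (Suc i) v = take i w @ [False]"
      using pre len w by (simp add: take_Suc_conv_app_nth)
    moreover from this have "count_list (drop (Suc i) v) True = A"
      using pre k append_take_drop_id[of "Suc i" v] count_list_append[of "take (Suc i) v" "drop (Suc i) v" True]
      by simp
    ultimately show "v \<in> E False A"
      using w by (simp add: E_def)
  qed
  have sub_S: "AE v in ?R. v \<in> E True (A - 1) \<longrightarrow> v \<in> ?S ?x0"
  proof (rule AE_pmfI, rule impI)
    fix v assume v: "v \<in> set_pmf ?R" "v \<in> E True (A - 1)"
    have len: "length v = n"
      using v by (simp add: length_replicate_pmf)
    have Suc_i: "take (Suc i) v = take i w @ [True]" "count_list (drop (Suc i) v) True = A - 1"
      using v w by (auto simp: E_def)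
    then have pre: "take i v = take i w" "v ! i"
      using len w by (auto simp: take_Suc_conv_app_nth)
    have "count_list v True = count_list (take (Suc i) v) True + (A - 1)"
      using Suc_i(2) by (metis append_take_drop_id count_list_append)
    then have count: "count_list v True = count_list w True"
      using Suc_i(1) k AB by (simp add: k_def)
    have "riffle v ! l = riffle w ! l" if "l < i" for l
    proof -
      have "take l (take i v) = take l (take i w)" "take i v ! l = take i w ! l"
        using pre(1) by simp_all
      then have "take l v = take l w" "v ! l = w ! l"
        using that by simp_all
      then show ?thesis
        using count that len w by (simp add: riffle_nth)
    qed
    then have "take i (riffle v) = take i (riffle w)"
      using len w by (intro nth_equalityI) auto
    then show "v \<in> ?S ?x0"
      using pre len w by (simp add: riffle_nth)
  qed
  show ?thesis
  proof (rule optimal_guess_unique[OF opt p w])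
    show "?x0 \<in> {1..n}"
      using count_le_length[of "take i w" True] w by simp
  next
    fix x assume x: "x \<noteq> ?x0"
    have "measure_pmf.prob ?R (?S x) \<le> measure_pmf.prob ?R (E False A)"
      by (rule measure_pmf.finite_measure_mono_AE[OF S_sub[OF x]]) simp
    also have "\<dots> = c * ((m choose A) * (p ^ A * (1 - p) ^ Suc (m - A)))"
      using p by (simp add: prob_E)
    \<comment> \<open>If \<open>A = m + 1\<close>, then \<open>m - A\<close> is truncated to 0, but
      the binomial coefficient vanishes on both sides.\<close>
    also have "\<dots> = c * ((m choose A) * (p ^ A * (1 - p) ^ B))"
    proof (cases "A \<le> m")
      case True
      then have "Suc (m - A) = B" using AB by simp
      then show ?thesis by simp
    qed simp
    also have "\<dots> < c * ((m choose (A - 1)) * (p ^ A * (1 - p) ^ B))"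
      using p c choose_less_choose_pred[of m A] AB
      by (intro mult_strict_left_mono mult_strict_right_mono) auto
    also have "\<dots> = c * p * ((m choose (A - 1)) * p ^ (A - 1) * (1 - p) ^ (m - (A - 1)))"
    proof -
      have "p ^ A = p * p ^ (A - 1)" "m - (A - 1) = B"
        using AB by (auto simp flip: power_Suc)
      then show ?thesis by simp
    qed
    also have "\<dots> = measure_pmf.prob ?R (E True (A - 1))"
      using p by (simp add: prob_E)
    also have "\<dots> \<le> measure_pmf.prob ?R (?S ?x0)"
      by (rule measure_pmf.finite_measure_mono_AE[OF sub_S]) simp
    finally show "measure_pmf.prob ?R (?S x) < measure_pmf.prob ?R (?S ?x0)" .
  qed
qed

text \<open>Before and after the first \<open>b\<close> the forced guess is the label of the next
  \<open>a\<close>. At a \<open>b\<close> it is wrong: some \<open>a\<close> is still to come, so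
  the guess is at most the number of \<open>a\<close>'s while the card is above it.\<close>

lemma correct_guesses_a_dominant:
  assumes opt: "optimal_strategy n p g" and p: "1 / 2 < p" "p < 1"
    and w: "length w = n" "a_dominant w"
  shows "correct_guesses g (riffle w) = count_list w True"
proof -
  have guess: "g (take i (riffle w)) = Suc (count_list (take i w) True)" if i: "i < n" for i
  proof (cases "False \<in> set (take i w)")
    case True
    then show ?thesis
      using a_dominant_count[OF w(2)] i w p by (intro optimal_guess_after_visible_b[OF opt]) auto
  next
    case False
    then have "count_list (take i w) True = i"
      using count_list_True_plus_False[of "take i w"] i w by simp
    then show ?thesis
      using optimal_guess_before_visible_b[OF opt p w(1) i False] by simp
  qed
  have "g (take i (riffle w)) = riffle w ! i \<longleftrightarrow> w ! i" if i: "i < n" for i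
  proof (cases "w ! i")
    case True
    then show ?thesis using guess[OF i] i w by (simp add: riffle_nth)
  next
    case False
    have "count_list (drop i w) True > 0"
      using a_dominant_count[OF w(2)] i w by (metis gr_implies_not0 not_gr0)
    moreover have "count_list w True = count_list (take i w) True + count_list (drop i w) True"
      by (metis append_take_drop_id count_list_append)
    ultimately show ?thesis using False guess[OF i] i w by (simp add: riffle_nth)
  qed
  then have "{i. i < length (riffle w) \<and> g (take i (riffle w)) = riffle w ! i} =
      {i. i < length w \<and> True = w ! i}"
    using w by auto
  then show ?thesis
    unfolding correct_guesses_def
    by (simp only: count_list_eq_length_filter length_filter_conv_card)
qed

section \<open>Probability of a word that is not a-dominant\<close>

text \<open>At most \<open>2 ^ m\<close> words qualify, and each has at least \<open>m / 2\<close>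
  letters \<open>b\<close>, hence probability at most \<open>sqrt (1 - p) ^ m\<close>.\<close>

lemma prob_count_list_False_ge_half:
  fixes p :: real
  assumes p: "0 \<le> p" "p \<le> 1"
  shows "measure_pmf.prob (replicate_pmf m (bernoulli_pmf p)) {w. count_list w True \<le> count_list w False}
           \<le> (2 * sqrt (1 - p)) ^ m"
proof -
  let ?L = "{w :: bool list. set w \<subseteq> UNIV \<and> length w = m}"
  let ?R = "replicate_pmf m (bernoulli_pmf p)"
  let ?H = "{w. count_list w True \<le> count_list w False}"
  have fin: "finite (?H \<inter> ?L)"
    using finite_lists_length_eq[of "UNIV :: bool set" m] by simp
  have pmf_le: "pmf (replicate_pmf (length w) (bernoulli_pmf p)) w \<le> (1 - p) ^ count_list w False" for w
  proof -
    have "pmf (replicate_pmf (length w) (bernoulli_pmf p)) w =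
        measure_pmf.prob (replicate_pmf (length w) (bernoulli_pmf p)) {v. take (length w) v = w}"
      unfolding measure_pmf_single[symmetric]
      by (rule measure_prob_cong_0) (auto simp: length_replicate_pmf set_pmf_iff[symmetric] pmf_eq_0_set_pmf)
    also have "\<dots> = (\<Prod>x\<leftarrow>w. pmf (bernoulli_pmf p) x)"
      by (rule prob_replicate_pmf_prefix') simp
    also have "\<dots> \<le> (1 - p) ^ count_list w False"
    proof (induction w)
      case (Cons x w)
      have "0 \<le> (\<Prod>x\<leftarrow>w. pmf (bernoulli_pmf p) x)"
        by (intro prod_list_nonneg) auto
      then show ?case
        using Cons p mult_mono[of p 1 "\<Prod>x\<leftarrow>w. pmf (bernoulli_pmf p) x" "(1 - p) ^ count_list w False"]
        by (cases x) (auto intro!: mult_left_mono)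
    qed simp
    finally show ?thesis .
  qed
  have "measure_pmf.prob ?R ?H = measure_pmf.prob ?R (?H \<inter> ?L)"
    by (rule measure_prob_cong_0) (auto simp: length_replicate_pmf pmf_eq_0_set_pmf)
  also have "\<dots> = (\<Sum>w\<in>?H \<inter> ?L. pmf ?R w)"
    using fin by (rule measure_measure_pmf_finite)
  also have "\<dots> \<le> (\<Sum>w\<in>?H \<inter> ?L. sqrt (1 - p) ^ m)"
  proof (rule sum_mono)
    fix w assume w: "w \<in> ?H \<inter> ?L"
    then have m: "m \<le> 2 * count_list w False"
      using count_list_True_plus_False[of w] by auto
    have "pmf ?R w \<le> (1 - p) ^ count_list w False"
      using pmf_le[of w] w by auto
    also have "\<dots> = sqrt (1 - p) ^ (2 * count_list w False)"
      using p by (simp add: power_mult)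
    also have "\<dots> \<le> sqrt (1 - p) ^ m"
      using m p by (intro power_decreasing) auto
    finally show "pmf ?R w \<le> sqrt (1 - p) ^ m" .
  qed
  also have "\<dots> = card (?H \<inter> ?L) * sqrt (1 - p) ^ m"
    by simp
  also have "\<dots> \<le> 2 ^ m * sqrt (1 - p) ^ m"
  proof -
    have "card (?H \<inter> ?L) \<le> card ?L"
      using finite_lists_length_eq[of "UNIV :: bool set" m] by (intro card_mono) auto
    also have "\<dots> = 2 ^ m"
      using card_lists_length_eq[of "UNIV :: bool set" m] by simp
    finally have "real (card (?H \<inter> ?L)) \<le> real (2 ^ m)"
      by (simp only: of_nat_le_iff)
    then show ?thesis
      using p by (intro mult_right_mono) simp_all
  qed
  finally show ?thesis
    by (simp add: power_mult_distrib)
qed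

text \<open>Union bound over suffixes: either the whole word lacks a majority of \<open>a\<close>,
  or the fault lies in its tail, which is distributed as a random word one letter shorter.\<close>

lemma prob_not_a_dominant_sum:
  fixes p :: real
  assumes p: "0 \<le> p" "p \<le> 1"
  shows "measure_pmf.prob (replicate_pmf n (bernoulli_pmf p)) {w. \<not> a_dominant w}
           \<le> (\<Sum>m<n. (2 * sqrt (1 - p)) ^ Suc m)"
proof (induction n)
  case (Suc n)
  let ?R = "\<lambda>n. replicate_pmf n (bernoulli_pmf p)"
  have tl: "map_pmf tl (?R (Suc n)) = ?R n"
    by (simp add: replicate_pmf_Suc_map map_bind_pmf map_pmf_comp del: replicate_pmf.simps)
  have "measure_pmf.prob (?R (Suc n)) {w. \<not> a_dominant w} \<le>
      measure_pmf.prob (?R (Suc n)) ({w. count_list w True \<le> count_list w False} \<union> tl -` {w. \<not> a_dominant w})"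
  proof (rule measure_pmf.finite_measure_mono)
    have "\<not> a_dominant w \<Longrightarrow> count_list w True \<le> count_list w False \<or> \<not> a_dominant (tl w)" for w
      by (cases w) auto
    then show "{w. \<not> a_dominant w} \<subseteq> {w. count_list w True \<le> count_list w False} \<union> tl -` {w. \<not> a_dominant w}"
      by auto
  qed simp
  also have "\<dots> \<le> measure_pmf.prob (?R (Suc n)) {w. count_list w True \<le> count_list w False} +
      measure_pmf.prob (?R (Suc n)) (tl -` {w. \<not> a_dominant w})"
    by (rule measure_Un_le) auto
  also have "measure_pmf.prob (?R (Suc n)) (tl -` {w. \<not> a_dominant w}) =
      measure_pmf.prob (?R n) {w. \<not> a_dominant w}"
    by (simp only: measure_map_pmf[symmetric] tl)
  also have "measure_pmf.prob (?R (Suc n)) {w. count_list w True \<le> count_list w False} +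
      measure_pmf.prob (?R n) {w. \<not> a_dominant w} \<le>
      (2 * sqrt (1 - p)) ^ Suc n + (\<Sum>m<n. (2 * sqrt (1 - p)) ^ Suc m)"
    by (intro add_mono Suc.IH prob_count_list_False_ge_half p)
  finally show ?case
    by simp
qed simp

text \<open>Geometric series with ratio \<open>x = 2 * sqrt (1 - p)\<close>; the bound
  \<open>15 / 16\<close> on \<open>p\<close> makes \<open>x\<close> at most 1/2, so the sum is at
  most \<open>2 * x\<close>.\<close>

lemma prob_not_a_dominant:
  fixes p :: real
  assumes p: "15 / 16 \<le> p" "p \<le> 1"
  shows "measure_pmf.prob (replicate_pmf n (bernoulli_pmf p)) {w. \<not> a_dominant w} \<le> 4 * sqrt (1 - p)"
proof -
  define x where "x = 2 * sqrt (1 - p)"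
  have "sqrt (1 - p) \<le> 1 / 4"
    using p by (intro real_le_lsqrt) (auto simp: power2_eq_square)
  then have x: "0 \<le> x" "x \<le> 1 / 2"
    using p by (auto simp: x_def)
  \<comment> \<open>The factor \<open>1 - x ^ n\<close> makes the induction close; the 2 bounds
    \<open>1 / (1 - x)\<close>.\<close>
  have sum: "(\<Sum>m<n. x ^ Suc m) \<le> 2 * x * (1 - x ^ n)" for n
  proof (induction n)
    case (Suc n)
    have "x * x ^ n \<le> 2 * x * (1 - x) * x ^ n"
      using x mult_left_mono[of "2 * x" 1 x] by (intro mult_right_mono) (auto simp: algebra_simps)
    then show ?case
      using Suc by (simp add: algebra_simps)
  qed simp
  have "2 * x * (1 - x ^ n) \<le> 2 * x"
    using x by (intro mult_right_le_one_le) (auto simp: power_le_one)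
  then show ?thesis
    using prob_not_a_dominant_sum[of p n] sum[of n] p by (simp add: x_def)
qed

section \<open>Characteristic functions\<close>

lemma char_distr_pmf:
  "char (distr (measure_pmf M) borel f) t = (LINT x|measure_pmf M. iexp (t * f x))"
  by (simp add: char_def integral_distr)

lemma integrable_iexp_pmf: "integrable (measure_pmf M) (\<lambda>x. iexp (f x))"
  by (rule measure_pmf.integrable_const_bound[where B = 1]) auto

lemma char_return_0: "char (return borel 0) t = 1"
  by (simp add: char_def integral_return)

lemma char_poisson_pmf:
  assumes "0 < lam"
  shows "char (distr (poisson_pmf lam) borel real) t = exp (complex_of_real lam * (iexp t - 1))"
proof -
  let ?f = "\<lambda>k. pmf (poisson_pmf lam) k *\<^sub>R iexp (t * real k)"
  \<comment> \<open>Turning the integral into a series needs integrability over the counting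
    measure, inherited from a bounded function under the probability measure.\<close>
  have "integrable (density (count_space UNIV) (pmf (poisson_pmf lam))) (\<lambda>k. iexp (t * real k))"
    using integrable_iexp_pmf[of "poisson_pmf lam" "\<lambda>k. t * real k"]
    by (simp only: measure_pmf_eq_density)
  then have int: "integrable (count_space UNIV) ?f"
    by (subst (asm) integrable_density) auto
  have f: "?f k = complex_of_real (exp (- lam)) * ((complex_of_real lam * iexp t) ^ k /\<^sub>R fact k)" for k
    using assms
    by (simp add: scaleR_conv_of_real power_mult_distrib exp_of_nat_mult[symmetric] field_simps)
  have "char (distr (poisson_pmf lam) borel real) t = (LINT k|count_space UNIV. ?f k)"
    unfolding char_distr_pmf unfolding measure_pmf_eq_density by (subst integral_density) auto
  also have "\<dots> = (\<Sum>k. ?f k)"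
    by (rule integral_count_space_nat[OF int])
  also have "\<dots> = complex_of_real (exp (- lam)) * exp (complex_of_real lam * iexp t)"
    unfolding f by (intro sums_unique[symmetric] sums_mult exp_converges)
  finally show ?thesis
    by (simp add: exp_of_real[symmetric] exp_add[symmetric] algebra_simps)
qed

text \<open>The number of \<open>b\<close>'s is \<open>n\<close> minus a binomial number of
  \<open>a\<close>'s; the binomial theorem applies with the phase attached to the exponent
  \<open>n - k\<close>.\<close>

lemma char_count_list_False:
  assumes "0 \<le> p" "p \<le> (1 :: real)"
  shows "(LINT w|measure_pmf (replicate_pmf n (bernoulli_pmf p)). iexp (u * real (count_list w False))) =
     (complex_of_real p + complex_of_real (1 - p) * iexp u) ^ n"
proof -
  let ?R = "replicate_pmf n (bernoulli_pmf p)"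
  have p: "p \<in> {0..1}"
    using assms by simp
  have count: "count_list w False = length w - length (filter id w)" for w
    by (induction w) (auto simp: Suc_diff_le)
  have "(LINT w|measure_pmf ?R. iexp (u * real (count_list w False))) =
      (LINT w|measure_pmf ?R. iexp (u * real (n - (length \<circ> filter id) w)))"
    by (intro integral_cong_AE AE_pmfI) (auto simp: count length_replicate_pmf)
  also have "\<dots> = (LINT k|measure_pmf (binomial_pmf n p). iexp (u * real (n - k)))"
    unfolding binomial_pmf_altdef[OF p] by simp
  also have "\<dots> = (\<Sum>k\<le>n. (real (n choose k) * p ^ k * (1 - p) ^ (n - k)) *\<^sub>R iexp (u * real (n - k)))"
    by (rule expectation_binomial_pmf'[OF p])
  also have "\<dots> = (complex_of_real p + complex_of_real (1 - p) * iexp u) ^ n"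
    unfolding binomial_ring
  proof (rule sum.cong)
    fix k
    have "iexp (u * real (n - k)) = iexp u ^ (n - k)"
      by (simp add: exp_of_nat_mult[symmetric] mult_ac)
    then show "(real (n choose k) * p ^ k * (1 - p) ^ (n - k)) *\<^sub>R iexp (u * real (n - k)) =
        of_nat (n choose k) * complex_of_real p ^ k * (complex_of_real (1 - p) * iexp u) ^ (n - k)"
      by (simp add: scaleR_conv_of_real power_mult_distrib)
  qed simp
  finally show ?thesis .
qed

text \<open>Values in the unit disc differ by at most 2. This transfers limits between statistics
  that agree with high probability.\<close>

lemma norm_integral_pmf_diff_le:
  fixes f h :: "'a \<Rightarrow> complex"
  assumes "\<And>x. norm (f x) \<le> 1" "\<And>x. norm (h x) \<le> 1"
  shows "norm ((LINT x|measure_pmf M. f x) - (LINT x|measure_pmf M. h x)) \<le>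
           2 * measure_pmf.prob M {x. f x \<noteq> h x}"
proof -
  have int: "integrable (measure_pmf M) f" "integrable (measure_pmf M) h"
    using assms by (auto intro!: measure_pmf.integrable_const_bound[where B = 1])
  have "norm ((LINT x|measure_pmf M. f x) - (LINT x|measure_pmf M. h x)) =
      norm (LINT x|measure_pmf M. f x - h x)"
    using int by simp
  also have "\<dots> \<le> (LINT x|measure_pmf M. norm (f x - h x))"
    by (rule integral_norm_bound)
  also have "\<dots> \<le> (LINT x|measure_pmf M. 2 * indicator {x. f x \<noteq> h x} x)"
  proof (rule integral_mono)
    show "norm (f x - h x) \<le> 2 * indicator {x. f x \<noteq> h x} x" for x
      using norm_triangle_ineq4[of "f x" "h x"] assms[of x] by (auto simp: indicator_def)
  qed (use int in \<open>auto intro!: measure_pmf.integrable_const_bound[where B = 2] AE_pmfI simp: indicator_def\<close>)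
  also have "\<dots> = 2 * measure_pmf.prob M {x. f x \<noteq> h x}"
    by simp
  finally show ?thesis .
qed

section \<open>Binomial, Poisson and normal characteristic functions compared\<close>

text \<open>With \<open>z = q * (iexp u - 1)\<close> the terms are \<open>(1 + z) ^ n\<close> and
  \<open>exp z ^ n\<close>. Both bases lie in the unit disc, so the powers differ by at most
  \<open>n * norm (1 + z - exp z)\<close>, which a Taylor estimate makes quadratic in
  \<open>q * u\<close>.\<close>

lemma binomial_poisson_char_diff:
  assumes q: "0 \<le> q" "q \<le> 1"
  shows "norm ((complex_of_real (1 - q) + complex_of_real q * iexp u) ^ n -
             exp (of_nat n * complex_of_real q * (iexp u - 1))) \<le> exp 2 * (real n * q\<^sup>2 * u\<^sup>2)"
proof -
  define z where "z = complex_of_real q * (iexp u - 1)"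
  have "norm (iexp u - 1) \<le> \<bar>u\<bar>"
    using iexp_approx1[of u 0] by simp
  then have z_u: "norm z \<le> q * \<bar>u\<bar>"
    using q by (simp add: z_def norm_mult mult_left_mono)
  \<comment> \<open>This cruder bound, uniform in \<open>u\<close>, is the source of the constant
    \<open>exp 2\<close>.\<close>
  have "norm (iexp u - 1) \<le> 2"
    using norm_triangle_ineq4[of "iexp u" 1] by simp
  then have "norm z \<le> 1 * 2"
    using q unfolding z_def norm_mult by (intro mult_mono) auto
  then have Re_2: "\<bar>Re z\<bar> \<le> 2"
    using abs_Re_le_cmod[of z] by linarith
  have "Re (iexp u) \<le> 1"
    using complex_Re_le_cmod[of "iexp u"] by simp
  then have "Re z \<le> 0"
    using q by (simp add: z_def mult_nonneg_nonpos)
  then have exp_1: "norm (exp z) \<le> 1"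
    by simp
  have eq: "complex_of_real (1 - q) + complex_of_real q * iexp u = 1 + z"
    by (simp add: z_def algebra_simps)
  have "norm (1 + z) \<le> (1 - q) + q"
    unfolding eq[symmetric] using q norm_triangle_ineq[of "complex_of_real (1 - q)" "complex_of_real q * iexp u"]
    by (simp add: norm_mult del: of_real_diff)
  then have "norm ((1 + z) ^ n - exp z ^ n) \<le> n * norm (1 + z - exp z)"
    using exp_1 by (intro norm_power_diff) simp_all
  also have "\<dots> \<le> n * (exp 2 * (q * \<bar>u\<bar>)\<^sup>2)"
  proof (intro mult_left_mono)
    have "norm (1 + z - exp z) \<le> exp \<bar>Re z\<bar> * (norm z)\<^sup>2"
      using Taylor_exp[of z 1] by (simp add: norm_minus_commute power2_eq_square)
    also have "\<dots> \<le> exp 2 * (q * \<bar>u\<bar>)\<^sup>2"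
      using Re_2 z_u by (intro mult_mono power_mono) auto
    finally show "norm (1 + z - exp z) \<le> exp 2 * (q * \<bar>u\<bar>)\<^sup>2" .
  qed simp
  finally show ?thesis
    unfolding eq by (simp add: exp_of_nat_mult[symmetric] z_def mult_ac power_mult_distrib)
qed

text \<open>The phase \<open>iexp (b n)\<close>, which will carry the centring, has modulus 1 and
  leaves the comparison error unchanged.\<close>

lemma binomial_char_tendsto:
  fixes q u b :: "nat \<Rightarrow> real" and L :: complex
  assumes q: "\<forall>\<^sub>F n in sequentially. 0 \<le> q n \<and> q n \<le> 1"
    and small: "(\<lambda>n. real n * (q n)\<^sup>2 * (u n)\<^sup>2) \<longlonglongrightarrow> 0"
    and lim: "(\<lambda>n. iexp (b n) * exp (of_nat n * complex_of_real (q n) * (iexp (u n) - 1))) \<longlonglongrightarrow> L"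
  shows "(\<lambda>n. iexp (b n) * (complex_of_real (1 - q n) + complex_of_real (q n) * iexp (u n)) ^ n) \<longlonglongrightarrow> L"
proof -
  have "(\<lambda>n. iexp (b n) * (complex_of_real (1 - q n) + complex_of_real (q n) * iexp (u n)) ^ n -
      iexp (b n) * exp (of_nat n * complex_of_real (q n) * (iexp (u n) - 1))) \<longlonglongrightarrow> 0"
  proof (rule Lim_null_comparison)
    show "\<forall>\<^sub>F n in sequentially. norm (iexp (b n) * (complex_of_real (1 - q n) + complex_of_real (q n) * iexp (u n)) ^ n -
        iexp (b n) * exp (of_nat n * complex_of_real (q n) * (iexp (u n) - 1)))
        \<le> exp 2 * (real n * (q n)\<^sup>2 * (u n)\<^sup>2)"
      using q
    proof eventually_elim
      case (elim n)
      then show ?case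
        using binomial_poisson_char_diff[of "q n" "u n" n]
        unfolding right_diff_distrib[symmetric] norm_mult by simp
    qed
    show "(\<lambda>n. exp 2 * (real n * (q n)\<^sup>2 * (u n)\<^sup>2)) \<longlonglongrightarrow> 0"
      using tendsto_mult_right[OF small, of "exp 2"] by simp
  qed
  from tendsto_add[OF this lim] show ?thesis
    by simp
qed

text \<open>This is the characteristic function of a standardized Poisson variable of mean
  \<open>m n\<close>. For \<open>x = t / sqrt (m n)\<close>, centring cancels the linear term of
  \<open>iexp x\<close> and the quadratic term gives the Gaussian exponent.\<close>

lemma poisson_char_tendsto_normal:
  assumes m: "filterlim m at_top sequentially"
  shows "(\<lambda>n. iexp (- (t * m n / sqrt (m n))) *
           exp (complex_of_real (m n) * (iexp (t / sqrt (m n)) - 1))) \<longlonglongrightarrow> exp (- (t\<^sup>2) / 2)"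
proof -
  define x where "x n = t / sqrt (m n)" for n
  define R where "R n = iexp (x n) - (\<Sum>k\<le>2. (\<i> * complex_of_real (x n)) ^ k / fact k)" for n
  have pos: "\<forall>\<^sub>F n in sequentially. 0 < m n"
    using m by (simp add: filterlim_at_top_dense)
  have x: "x \<longlonglongrightarrow> 0"
    unfolding x_def
    by (rule tendsto_divide_0[OF tendsto_const])
       (rule filterlim_at_top_imp_at_infinity, rule filterlim_compose[OF sqrt_at_top m])
  have "(\<lambda>n. complex_of_real (m n) * R n) \<longlonglongrightarrow> 0"
  proof (rule Lim_null_comparison)
    show "\<forall>\<^sub>F n in sequentially. norm (complex_of_real (m n) * R n) \<le> t\<^sup>2 * \<bar>x n\<bar> / 6"
      using pos
    proof eventually_elim
      case (elim n)
      have mx: "m n * (x n)\<^sup>2 = t\<^sup>2"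
        using elim by (simp add: x_def power_divide)
      \<comment> \<open>The remainder is cubic with constant \<open>1 / fact 3\<close>. Two factors
        \<open>x n\<close> absorb \<open>m n\<close>, and the third tends to 0.\<close>
      have "norm (complex_of_real (m n) * R n) \<le> m n * (\<bar>x n\<bar> ^ 3 / 6)"
        using iexp_approx1[of "x n" 2] elim
        unfolding norm_mult R_def by (intro mult_mono) (auto simp: fact_numeral eval_nat_numeral)
      also have "\<dots> = m n * (x n)\<^sup>2 * \<bar>x n\<bar> / 6"
        by (simp add: power3_eq_cube power2_eq_square)
      finally show ?case
        by (simp add: mx)
    qed
    show "(\<lambda>n. t\<^sup>2 * \<bar>x n\<bar> / 6) \<longlonglongrightarrow> 0"
      using x by (auto intro!: tendsto_eq_intros)
  qed
  then have "(\<lambda>n. exp (complex_of_real (m n) * R n - complex_of_real (t\<^sup>2) / 2)) \<longlonglongrightarrow>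
      exp (0 - complex_of_real (t\<^sup>2) / 2)"
    by (intro tendsto_intros)
  moreover have "\<forall>\<^sub>F n in sequentially. exp (complex_of_real (m n) * R n - complex_of_real (t\<^sup>2) / 2) =
      iexp (- (t * m n / sqrt (m n))) * exp (complex_of_real (m n) * (iexp (t / sqrt (m n)) - 1))"
    using pos
  proof eventually_elim
    case (elim n)
    have t: "complex_of_real (t\<^sup>2) = complex_of_real (m n) * complex_of_real ((x n)\<^sup>2)"
      unfolding of_real_mult[symmetric] using elim by (simp add: x_def power_divide)
    have "R n = iexp (x n) - 1 - \<i> * complex_of_real (x n) + complex_of_real ((x n)\<^sup>2) / 2"
      by (simp add: R_def numeral_2_eq_2 power_mult_distrib)
    then have "complex_of_real (m n) * R n = complex_of_real (m n) *
        (iexp (x n) - 1 - \<i> * complex_of_real (x n) + complex_of_real ((x n)\<^sup>2) / 2)"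
      by simp
    then have exponent: "complex_of_real (m n) * R n - complex_of_real (t\<^sup>2) / 2 =
        \<i> * complex_of_real (- (m n * x n)) + complex_of_real (m n) * (iexp (x n) - 1)"
      unfolding t by (simp add: algebra_simps)
    have mx: "m n * x n = t * m n / sqrt (m n)"
      by (simp add: x_def)
    show ?case
      unfolding exponent exp_add mx unfolding x_def by (rule refl)
  qed
  ultimately show ?thesis
    by (simp add: tendsto_cong exp_of_real[symmetric])
qed

section \<open>Limit laws for the number of wrong guesses\<close>

text \<open>Levy continuity. Hypothesis \<open>lim\<close> concerns the centred and scaled number of
  \<open>b\<close>'s; it equals the number of wrong guesses on \<open>a\<close>-dominant words, and
  the exceptional probability vanishes as \<open>p n\<close> tends to 1.\<close>

lemma weak_conv_wrong_guesses:
  fixes p a s :: "nat \<Rightarrow> real"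
  assumes p: "p \<longlonglongrightarrow> 1" "\<forall>\<^sub>F n in sequentially. p n < 1"
    and opt: "\<And>n. 0 < p n \<Longrightarrow> p n < 1 \<Longrightarrow> optimal_strategy n (p n) (g n)"
    and M: "real_distribution M"
    and lim: "\<And>t. (\<lambda>n. iexp (- (t * a n / s n)) *
       (complex_of_real (p n) + complex_of_real (1 - p n) * iexp (t / s n)) ^ n) \<longlonglongrightarrow> char M t"
  shows "weak_conv_m (\<lambda>n. distr (deck_pmf n (p n)) borel
           (\<lambda>d. (real n - real (correct_guesses (g n) d) - a n) / s n)) M"
proof (rule levy_continuity[OF _ M])
  show "real_distribution (distr (deck_pmf n (p n)) borel
      (\<lambda>d. (real n - real (correct_guesses (g n) d) - a n) / s n))" for n
    by (rule prob_space.real_distribution_distr[OF prob_space_measure_pmf]) simp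
next
  fix t
  let ?C = "\<lambda>n. char (distr (deck_pmf n (p n)) borel
      (\<lambda>d. (real n - real (correct_guesses (g n) d) - a n) / s n)) t"
  let ?B = "\<lambda>n. iexp (- (t * a n / s n)) *
      (complex_of_real (p n) + complex_of_real (1 - p n) * iexp (t / s n)) ^ n"
  have ev: "\<forall>\<^sub>F n in sequentially. 15 / 16 < p n \<and> p n < 1"
    using p order_tendstoD(1)[OF p(1), of "15 / 16"] by (auto intro: eventually_conj)
  have "(\<lambda>n. ?C n - ?B n) \<longlonglongrightarrow> 0"
  proof (rule Lim_null_comparison)
    show "\<forall>\<^sub>F n in sequentially. norm (?C n - ?B n) \<le> 2 * (4 * sqrt (1 - p n))"
      using ev
    proof eventually_elim
      case (elim n)
      let ?R = "replicate_pmf n (bernoulli_pmf (p n))"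
      let ?f = "\<lambda>w. iexp (t * ((real n - real (correct_guesses (g n) (riffle w)) - a n) / s n))"
      let ?h = "\<lambda>w. iexp (t * ((real (count_list w False) - a n) / s n))"
      have "?C n = (LINT w|measure_pmf ?R. ?f w)"
        unfolding char_distr_pmf deck_pmf_def by simp
      moreover have "?B n = (LINT w|measure_pmf ?R. ?h w)"
      proof -
        have h: "?h w = iexp (- (t * a n / s n)) * iexp (t / s n * real (count_list w False))" for w
          unfolding exp_add[symmetric] by (simp add: algebra_simps diff_divide_distrib)
        show ?thesis
          unfolding h using elim char_count_list_False[of "p n" n "t / s n"] by simp
      qed
      ultimately have "norm (?C n - ?B n) \<le> 2 * measure_pmf.prob ?R {w. ?f w \<noteq> ?h w}"
        using norm_integral_pmf_diff_le[of ?f ?h ?R] by simp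
      also have "measure_pmf.prob ?R {w. ?f w \<noteq> ?h w} \<le> measure_pmf.prob ?R {w. \<not> a_dominant w}"
      proof (rule measure_pmf.finite_measure_mono_AE)
        show "AE w in ?R. w \<in> {w. ?f w \<noteq> ?h w} \<longrightarrow> w \<in> {w. \<not> a_dominant w}"
        proof (rule AE_pmfI, rule impI, rule ccontr)
          fix w assume w: "w \<in> set_pmf ?R" "w \<in> {w. ?f w \<noteq> ?h w}" "w \<notin> {w. \<not> a_dominant w}"
          then have len: "length w = n"
            by (simp add: length_replicate_pmf)
          have "correct_guesses (g n) (riffle w) = count_list w True"
            using elim opt[of n] len w(3) by (intro correct_guesses_a_dominant[of n "p n"]) auto
          then have "real n - real (correct_guesses (g n) (riffle w)) = real (count_list w False)"
            using count_list_True_plus_False[of w] len by simp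
          then have "?f w = ?h w"
            by (simp only:)
          then show False
            using w(2) by blast
        qed
      qed simp
      also have "\<dots> \<le> 4 * sqrt (1 - p n)"
        using elim by (intro prob_not_a_dominant) auto
      finally show ?case
        by simp
    qed
    show "(\<lambda>n. 2 * (4 * sqrt (1 - p n))) \<longlonglongrightarrow> 0"
      using p(1) by (auto intro!: tendsto_eq_intros)
  qed
  from tendsto_add[OF this lim[of t]] show "?C \<longlonglongrightarrow> char M t"
    by simp
qed

theorem mainTheorem8:
  fixes lam c :: real
    and p :: "nat \<Rightarrow> real"
    and g :: "nat \<Rightarrow> nat list \<Rightarrow> nat"
  assumes "lam > 0" and "c > 0"
    and "\<And>n. p n = 1 - lam * real n powr (- c)"
    and "\<And>n. 0 < p n \<Longrightarrow> p n < 1 \<Longrightarrow> optimal_strategy n (p n) (g n)"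
  shows
    "(c > 1 \<longrightarrow>
        weak_conv_m
          (\<lambda>n. distr (deck_pmf n (p n)) borel (\<lambda>d. real n - real (correct_guesses (g n) d)))
          (return borel 0)) \<and>
     (c = 1 \<longrightarrow>
        weak_conv_m
          (\<lambda>n. distr (deck_pmf n (p n)) borel (\<lambda>d. real n - real (correct_guesses (g n) d)))
          (distr (poisson_pmf lam) borel real)) \<and>
     (c < 1 \<longrightarrow>
        weak_conv_m
          (\<lambda>n. distr (deck_pmf n (p n)) borel
                 (\<lambda>d. (real n - real (correct_guesses (g n) d) - lam * real n powr (1 - c))
                        / sqrt (lam * real n powr (1 - c))))
          std_normal_distribution)"
proof -
  note p = assms(3) and opt = assms(4)
  define q where "q n = lam * real n powr (- c)" for n
  have pq: "p n = 1 - q n" for n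
    by (simp add: p q_def)
  have "(\<lambda>n. real n powr (- c)) \<longlonglongrightarrow> 0"
    using assms(2) by (intro tendsto_neg_powr filterlim_real_sequentially) simp
  from tendsto_mult_left[OF this, of lam] have q0: "q \<longlonglongrightarrow> 0"
    by (simp add: q_def[abs_def])
  have p1: "p \<longlonglongrightarrow> 1"
    unfolding pq[abs_def] using tendsto_diff[OF tendsto_const q0, of 1] by simp
  \<comment> \<open>Only eventually: \<open>q 0 = 0\<close> because \<open>0 powr _ = 0\<close>, and
    \<open>q n\<close> may exceed 1 for small positive \<open>n\<close>.\<close>
  have q_ev: "\<forall>\<^sub>F n in sequentially. 0 < q n \<and> q n \<le> 1"
    using eventually_gt_at_top[of 0] order_tendstoD(2)[OF q0 zero_less_one]
  proof eventually_elim
    case (elim n)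
    then show ?case using assms(1) by (simp add: q_def)
  qed
  then have p_ev: "\<forall>\<^sub>F n in sequentially. p n < 1"
    by eventually_elim (simp add: pq)
  have q_ev': "\<forall>\<^sub>F n in sequentially. 0 \<le> q n \<and> q n \<le> 1"
    using q_ev by eventually_elim simp
  \<comment> \<open>The expected number of letters \<open>b\<close>, which separates the three
    regimes.\<close>
  have nq: "real n * q n = lam * real n powr (1 - c)" for n
    by (cases "n = 0") (simp_all add: q_def powr_mult_base)
  \<comment> \<open>The cases \<open>c > 1\<close> and \<open>c = 1\<close> together, without
    centring or scaling: the limit is Poisson of mean \<open>mu\<close>, which for
    \<open>mu = 0\<close> degenerates to the point mass at 0.\<close>
  have fixed: "weak_conv_m (\<lambda>n. distr (deck_pmf n (p n)) borel (\<lambda>d. real n - real (correct_guesses (g n) d))) M"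
    if M: "real_distribution M" "\<And>t. char M t = exp (complex_of_real mu * (iexp t - 1))"
      and mu: "(\<lambda>n. real n * q n) \<longlonglongrightarrow> mu" for M mu
  proof -
    have "(\<lambda>n. iexp (- (t * 0 / 1)) * (complex_of_real (p n) + complex_of_real (1 - p n) * iexp (t / 1)) ^ n)
        \<longlonglongrightarrow> char M t" for t
    proof -
      have "(\<lambda>n. real n * q n * q n * t\<^sup>2) \<longlonglongrightarrow> mu * 0 * t\<^sup>2"
        by (intro tendsto_intros mu q0)
      then have small: "(\<lambda>n. real n * (q n)\<^sup>2 * t\<^sup>2) \<longlonglongrightarrow> 0"
        by (simp add: power2_eq_square mult.assoc)
      have "(\<lambda>n. iexp 0 * exp (complex_of_real (real n * q n) * (iexp t - 1))) \<longlonglongrightarrow>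
          iexp 0 * exp (complex_of_real mu * (iexp t - 1))"
        by (intro tendsto_intros mu)
      then have "(\<lambda>n. iexp 0 * exp (of_nat n * complex_of_real (q n) * (iexp t - 1))) \<longlonglongrightarrow> char M t"
        by (simp add: M)
      from binomial_char_tendsto[OF q_ev' small this] show ?thesis
        by (simp add: pq)
    qed
    from weak_conv_wrong_guesses[OF p1 p_ev opt M(1) this] show ?thesis
      by simp
  qed
  show ?thesis
  proof (intro conjI impI)
    assume "c > 1"
    then have "(\<lambda>n. lam * real n powr (1 - c)) \<longlonglongrightarrow> lam * 0"
      by (intro tendsto_mult_left tendsto_neg_powr filterlim_real_sequentially) simp
    then have mu: "(\<lambda>n. real n * q n) \<longlonglongrightarrow> 0"
      by (simp add: nq)
    have "real_distribution (return borel 0)"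
      unfolding real_distribution_def real_distribution_axioms_def by (simp add: prob_space_return)
    from fixed[OF this _ mu] show "weak_conv_m
        (\<lambda>n. distr (deck_pmf n (p n)) borel (\<lambda>d. real n - real (correct_guesses (g n) d))) (return borel 0)"
      by (simp add: char_return_0)
  next
    assume c: "c = 1"
    have "\<forall>\<^sub>F n in sequentially. real n * q n = lam"
      using eventually_gt_at_top[of 0] by eventually_elim (simp add: nq c)
    then have mu: "(\<lambda>n. real n * q n) \<longlonglongrightarrow> lam"
      by (rule tendsto_eventually)
    have "real_distribution (distr (poisson_pmf lam) borel real)"
      by (rule prob_space.real_distribution_distr[OF prob_space_measure_pmf]) simp
    from fixed[OF this char_poisson_pmf[OF assms(1)] mu] show "weak_conv_m
        (\<lambda>n. distr (deck_pmf n (p n)) borel (\<lambda>d. real n - real (correct_guesses (g n) d)))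
        (distr (poisson_pmf lam) borel real)" .
  next
    assume c: "c < 1"
    let ?m = "\<lambda>n. lam * real n powr (1 - c)"
    have m: "filterlim ?m at_top sequentially"
      using c assms(1) by real_asymp
    have "(\<lambda>n. iexp (- (t * ?m n / sqrt (?m n))) *
        (complex_of_real (p n) + complex_of_real (1 - p n) * iexp (t / sqrt (?m n))) ^ n)
        \<longlonglongrightarrow> char std_normal_distribution t" for t
    proof -
      \<comment> \<open>Dividing by the mean \<open>n * q n\<close> leaves only \<open>q n\<close>
        in the error, which vanishes for every \<open>c > 0\<close>; without the factor from the
        scaling, \<open>n * (q n) ^ 2\<close> would diverge for \<open>c < 1 / 2\<close>.\<close>
      have "\<forall>\<^sub>F n in sequentially. real n * (q n)\<^sup>2 * (t / sqrt (?m n))\<^sup>2 = q n * t\<^sup>2"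
        using q_ev eventually_gt_at_top[of 0]
      proof eventually_elim
        case (elim n)
        then show ?case
          unfolding nq[symmetric] by (simp add: power_divide power2_eq_square)
      qed
      moreover have "(\<lambda>n. q n * t\<^sup>2) \<longlonglongrightarrow> 0"
        using tendsto_mult[OF q0 tendsto_const, of "t\<^sup>2"] by simp
      ultimately have small: "(\<lambda>n. real n * (q n)\<^sup>2 * (t / sqrt (?m n))\<^sup>2) \<longlonglongrightarrow> 0"
        by (simp add: tendsto_cong)
      have "(\<lambda>n. iexp (- (t * ?m n / sqrt (?m n))) *
          exp (of_nat n * complex_of_real (q n) * (iexp (t / sqrt (?m n)) - 1)))
          \<longlonglongrightarrow> char std_normal_distribution t"
        using poisson_char_tendsto_normal[OF m, of t]
        by (simp add: char_std_normal_distribution nq[symmetric])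
      from binomial_char_tendsto[OF q_ev' small this] show ?thesis
        by (simp add: pq)
    qed
    from weak_conv_wrong_guesses[OF p1 p_ev opt _ this] show "weak_conv_m
        (\<lambda>n. distr (deck_pmf n (p n)) borel
          (\<lambda>d. (real n - real (correct_guesses (g n) d) - ?m n) / sqrt (?m n))) std_normal_distribution"
      by (simp add: real_dist_normal_dist)
  qed
qed

end
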